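(* Let $F$ be a field with two elements, let $n\geq 2$, and let $\mathcal{T}_n(F)$ be the ring of $n\times n$ upper triangular matrices over $F$. Then every Jordan derivation of the ring $\mathcal{T}_n(F)$ into itself is a derivation.
   Context: Here $\mathcal{T}_n(F)$ is considered as a ring and linearity over $F$ is not required of the maps. A Jordan derivation of a ring $R$ into itself is an additive map $D:R\to R$ with $D(a^2)=D(a)a+aD(a)$ for all $a\in R$. A derivation of a ring $R$ is an additive map $D:R\to R$ with $D(ab)=D(a)b+aD(b)$ for all $a,b\in R$. *)

theory Defs
  imports "Jordan_Normal_Form.Matrix" "HOL-Algebra.Subrings"
begin

text \<open>
  The predicates below constrain a map only on the carrier of the ring; its values elsewhere are
  irrelevant. Membership in \<open>hom (add_monoid R) (add_monoid R)\<close> says that the map sends the carrier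
  of \<open>R\<close> to itself and is additive there.
\<close>

definition derivation :: "('a, 'm) ring_scheme \<Rightarrow> ('a \<Rightarrow> 'a) \<Rightarrow> bool" where
  "derivation R D \<longleftrightarrow>
     D \<in> hom (add_monoid R) (add_monoid R) \<and>
     (\<forall>a\<in>carrier R. \<forall>b\<in>carrier R. D (a \<otimes>\<^bsub>R\<^esub> b) = D a \<otimes>\<^bsub>R\<^esub> b \<oplus>\<^bsub>R\<^esub> a \<otimes>\<^bsub>R\<^esub> D b)"

definition jordan_derivation :: "('a, 'm) ring_scheme \<Rightarrow> ('a \<Rightarrow> 'a) \<Rightarrow> bool" where
  "jordan_derivation R D \<longleftrightarrow>
     D \<in> hom (add_monoid R) (add_monoid R) \<and>
     (\<forall>a\<in>carrier R. D (a [^]\<^bsub>R\<^esub> (2::nat)) = D a \<otimes>\<^bsub>R\<^esub> a \<oplus>\<^bsub>R\<^esub> a \<otimes>\<^bsub>R\<^esub> D a)"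

definition upper_triangular_ring :: "'f::field itself \<Rightarrow> nat \<Rightarrow> 'f mat ring" where
  "upper_triangular_ring F n =
     (ring_mat F n ())\<lparr>carrier := {A \<in> carrier_mat n n. upper_triangular A}\<rparr>"

lemma upper_triangular_mult:
  fixes A B :: "'f::semiring_0 mat"
  assumes A: "A \<in> carrier_mat n n" "upper_triangular A"
    and B: "B \<in> carrier_mat n n" "upper_triangular B"
  shows "upper_triangular (A * B)"
proof (rule upper_triangularI)
  fix i j assume ij: "j < i" "i < dim_row (A * B)"
  have "A $$ (i, k) * B $$ (k, j) = 0" if "k < n" for k
  proof (cases "k < i")
    case True
    then show ?thesis using A ij upper_triangularD[of A k i] by simp
  next
    case False
    then show ?thesis using B ij that upper_triangularD[of B j k] by simp
  qed
  then show "(A * B) $$ (i, j) = 0"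
    using A B ij by (simp add: scalar_prod_def)
qed

lemma upper_triangular_subring:
  "subring {A \<in> carrier_mat n n. upper_triangular A} (ring_mat TYPE('f::field) n b)"
proof -
  interpret ring "ring_mat TYPE('f) n b" by (rule ring_mat)
  have minus: "\<ominus>\<^bsub>ring_mat TYPE('f) n b\<^esub> A = - A" if "A \<in> carrier_mat n n" for A
    using that by (intro minus_equality) (auto simp: ring_mat_simps)
  show ?thesis
  proof (rule subringI)
    show "\<ominus>\<^bsub>ring_mat TYPE('f) n b\<^esub> A \<in> {A \<in> carrier_mat n n. upper_triangular A}"
      if "A \<in> {A \<in> carrier_mat n n. upper_triangular A}" for A
      using that by (auto simp: minus upper_triangular_def)
  qed (auto simp: ring_mat_simps upper_triangular_mult, auto simp: upper_triangular_def)
qed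

lemma ring_upper_triangular_ring: "ring (upper_triangular_ring TYPE('f::field) n)"
  unfolding upper_triangular_ring_def
  by (rule ring.subring_is_ring[OF ring_mat upper_triangular_subring])

end

theory Submission
  imports Defs
begin

text \<open>
  Every Jordan derivation \<open>D\<close> of the ring is inner. Writing \<open>e\<^sub>i\<^sub>j\<close> for the matrix units, put
  \<open>Y\<^sub>i\<^sub>j = D(e\<^sub>i\<^sub>i)\<^sub>i\<^sub>j\<close> for \<open>i < j\<close> and \<open>Y\<^sub>j\<^sub>j = D(e\<^sub>0\<^sub>j)\<^sub>0\<^sub>j\<close>, and subtract from \<open>D\<close> the inner derivation
  \<open>A \<mapsto> A Y - Y A\<close>. The resulting Jordan derivation kills every \<open>e\<^sub>i\<^sub>i\<close>; polarising
  \<open>e\<^sub>i\<^sub>j = e\<^sub>i\<^sub>i e\<^sub>i\<^sub>j + e\<^sub>i\<^sub>j e\<^sub>i\<^sub>i = e\<^sub>i\<^sub>j e\<^sub>j\<^sub>j + e\<^sub>j\<^sub>j e\<^sub>i\<^sub>j\<close> shows that it maps \<open>e\<^sub>i\<^sub>j\<close> to a multiple \<open>c\<^sub>i\<^sub>j e\<^sub>i\<^sub>j\<close>,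
  where \<open>c\<^sub>0\<^sub>j = 0\<close> by the choice of the diagonal of \<open>Y\<close>, and then \<open>c\<^sub>0\<^sub>j = c\<^sub>0\<^sub>i + c\<^sub>i\<^sub>j\<close> gives
  \<open>c\<^sub>i\<^sub>j = 0\<close>. Over the field with two elements the matrix units generate the additive group.
\<close>

subsection \<open>Jordan derivations and inner derivations of rings\<close>

context ring
begin

lemma jordan_derivation_closed:
  assumes "jordan_derivation R D" "a \<in> carrier R"
  shows "D a \<in> carrier R"
  using assms by (auto simp: jordan_derivation_def hom_def)

lemma jordan_derivation_add:
  assumes "jordan_derivation R D" "a \<in> carrier R" "b \<in> carrier R"
  shows "D (a \<oplus> b) = D a \<oplus> D b"
  using assms by (auto simp: jordan_derivation_def hom_def)

lemma jordan_derivation_square: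
  assumes "jordan_derivation R D" "a \<in> carrier R"
  shows "D (a \<otimes> a) = D a \<otimes> a \<oplus> a \<otimes> D a"
  using assms by (auto simp: jordan_derivation_def numeral_2_eq_2)

text \<open>Expand \<open>D ((a \<oplus> b) \<otimes> (a \<oplus> b))\<close> once by additivity and
  once by the square rule, then cancel the two square terms. There is no division by two, so
  characteristic 2 is covered.\<close>

lemma jordan_derivation_polarised:
  assumes D: "jordan_derivation R D" and a: "a \<in> carrier R" and b: "b \<in> carrier R"
  shows "D (a \<otimes> b \<oplus> b \<otimes> a) = D a \<otimes> b \<oplus> a \<otimes> D b \<oplus> D b \<otimes> a \<oplus> b \<otimes> D a"
proof -
  note cl = a b jordan_derivation_closed[OF D a] jordan_derivation_closed[OF D b]
  have "(a \<oplus> b) \<otimes> (a \<oplus> b) = (a \<otimes> a \<oplus> b \<otimes> b) \<oplus> (a \<otimes> b \<oplus> b \<otimes> a)"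
    using a b by (simp add: l_distr r_distr a_ac)
  then have "D ((a \<oplus> b) \<otimes> (a \<oplus> b)) = (D (a \<otimes> a) \<oplus> D (b \<otimes> b)) \<oplus> D (a \<otimes> b \<oplus> b \<otimes> a)"
    using a b by (simp add: jordan_derivation_add[OF D])
  moreover have "D ((a \<oplus> b) \<otimes> (a \<oplus> b)) = (D (a \<otimes> a) \<oplus> D (b \<otimes> b))
      \<oplus> (D a \<otimes> b \<oplus> a \<otimes> D b \<oplus> D b \<otimes> a \<oplus> b \<otimes> D a)"
    unfolding jordan_derivation_square[OF D a_closed[OF a b]]
    using cl by (simp add: jordan_derivation_add[OF D] jordan_derivation_square[OF D] l_distr r_distr a_ac)
  moreover have "D (a \<otimes> b \<oplus> b \<otimes> a) \<in> carrier R" "D (a \<otimes> a) \<oplus> D (b \<otimes> b) \<in> carrier R"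
    using a b by (auto intro!: jordan_derivation_closed[OF D] a_closed)
  ultimately show ?thesis
    using cl by simp
qed

lemma derivation_inner:
  assumes y: "y \<in> carrier R"
  shows "derivation R (\<lambda>a. a \<otimes> y \<ominus> y \<otimes> a)"
  unfolding derivation_def
proof (intro conjI ballI)
  show "(\<lambda>a. a \<otimes> y \<ominus> y \<otimes> a) \<in> hom (add_monoid R) (add_monoid R)"
    using y by (auto simp: hom_def minus_eq l_distr r_distr minus_add a_ac)
  fix a b assume ab: "a \<in> carrier R" "b \<in> carrier R"
  \<comment> \<open>The cancelling pair with \<open>a \<otimes> y \<otimes> b\<close> is inserted so
    that the terms regroup into the two commutators.\<close>
  have "a \<otimes> b \<otimes> y \<ominus> y \<otimes> (a \<otimes> b)
      = (\<ominus> (y \<otimes> a \<otimes> b) \<oplus> (a \<otimes> y \<otimes> b \<oplus> \<ominus> (a \<otimes> y \<otimes> b))) \<oplus> a \<otimes> b \<otimes> y"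
    using ab y by (simp add: r_neg minus_eq m_assoc a_comm)
  also have "\<dots> = (a \<otimes> y \<ominus> y \<otimes> a) \<otimes> b \<oplus> a \<otimes> (b \<otimes> y \<ominus> y \<otimes> b)"
    using ab y by (simp add: minus_eq l_distr r_distr l_minus r_minus m_assoc a_ac)
  finally show "a \<otimes> b \<otimes> y \<ominus> y \<otimes> (a \<otimes> b)
      = (a \<otimes> y \<ominus> y \<otimes> a) \<otimes> b \<oplus> a \<otimes> (b \<otimes> y \<ominus> y \<otimes> b)" .
qed

text \<open>This permits normalising a Jordan derivation by subtracting an inner derivation.\<close>

lemma jordan_derivation_diff_derivation:
  assumes D: "jordan_derivation R D" and d: "derivation R d"
  shows "jordan_derivation R (\<lambda>a. D a \<ominus> d a)"
  unfolding jordan_derivation_def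
proof (intro conjI ballI)
  have d_closed: "d a \<in> carrier R" if "a \<in> carrier R" for a
    using d that by (auto simp: derivation_def hom_def)
  have d_add: "d (a \<oplus> b) = d a \<oplus> d b" if "a \<in> carrier R" "b \<in> carrier R" for a b
    using d that by (auto simp: derivation_def hom_def)
  note simps = D d_closed d_add jordan_derivation_closed jordan_derivation_add
    jordan_derivation_square minus_eq minus_add l_distr r_distr l_minus r_minus a_ac
  show "(\<lambda>a. D a \<ominus> d a) \<in> hom (add_monoid R) (add_monoid R)"
    by (auto simp: hom_def simps)
  fix a assume a: "a \<in> carrier R"
  have "d (a \<otimes> a) = d a \<otimes> a \<oplus> a \<otimes> d a"
    using d a by (simp add: derivation_def)
  then show "D (a [^] (2::nat)) \<ominus> d (a [^] (2::nat)) = (D a \<ominus> d a) \<otimes> a \<oplus> a \<otimes> (D a \<ominus> d a)"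
    using a by (simp add: numeral_2_eq_2 simps)
qed

lemma derivation_cong:
  assumes d: "derivation R d" and eq: "\<And>a. a \<in> carrier R \<Longrightarrow> D a = d a"
  shows "derivation R D"
  using d by (auto simp: derivation_def hom_def eq)

end

subsection \<open>Upper triangular matrices\<close>

lemma upper_triangular_ring_simps [simp]:
  "carrier (upper_triangular_ring TYPE('f::field) n) = {A \<in> carrier_mat n n. upper_triangular A}"
  "A \<oplus>\<^bsub>upper_triangular_ring TYPE('f) n\<^esub> B = A + B"
  "A \<otimes>\<^bsub>upper_triangular_ring TYPE('f) n\<^esub> B = A * B"
  "\<zero>\<^bsub>upper_triangular_ring TYPE('f) n\<^esub> = 0\<^sub>m n n"
  by (simp_all add: upper_triangular_ring_def ring_mat_simps)

text \<open>Ring subtraction is defined through the inverse in the additive monoid; uniqueness of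
  that inverse identifies it with matrix negation.\<close>

lemma upper_triangular_ring_minus:
  fixes A B :: "'f::field mat"
  assumes "A \<in> carrier_mat n n" "upper_triangular A" "B \<in> carrier_mat n n" "upper_triangular B"
  shows "A \<ominus>\<^bsub>upper_triangular_ring TYPE('f) n\<^esub> B = A - B"
proof -
  interpret ring "upper_triangular_ring TYPE('f) n" by (rule ring_upper_triangular_ring)
  have "\<ominus>\<^bsub>upper_triangular_ring TYPE('f) n\<^esub> B = - B"
    using assms by (intro minus_equality) (auto simp: upper_triangular_def)
  then show ?thesis
    using assms by (auto simp: minus_eq)
qed

lemma upper_triangular_minus:
  fixes A B :: "'a::group_add mat"
  assumes "A \<in> carrier_mat n n" "upper_triangular A" "B \<in> carrier_mat n n" "upper_triangular B"
  shows "upper_triangular (A - B)"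
  using assms by (auto simp: upper_triangular_def)

lemma upper_triangular_commutator:
  fixes A Y :: "'f::field mat"
  assumes A: "A \<in> carrier_mat n n" "upper_triangular A" and Y: "Y \<in> carrier_mat n n" "upper_triangular Y"
  shows "A * Y - Y * A \<in> carrier_mat n n" "upper_triangular (A * Y - Y * A)"
    and "A * Y \<ominus>\<^bsub>upper_triangular_ring TYPE('f) n\<^esub> Y * A = A * Y - Y * A"
proof -
  have AY: "A * Y \<in> carrier_mat n n" "upper_triangular (A * Y)"
    and YA: "Y * A \<in> carrier_mat n n" "upper_triangular (Y * A)"
    using A Y by (auto intro: upper_triangular_mult)
  show "A * Y - Y * A \<in> carrier_mat n n" "upper_triangular (A * Y - Y * A)"
    "A * Y \<ominus>\<^bsub>upper_triangular_ring TYPE('f) n\<^esub> Y * A = A * Y - Y * A"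
    using minus_carrier_mat[OF YA(1)] upper_triangular_minus[OF AY YA] upper_triangular_ring_minus[OF AY YA] by auto
qed

section \<open>Matrix units\<close>

definition unit_mat :: "nat \<Rightarrow> nat \<Rightarrow> nat \<Rightarrow> 'a::zero_neq_one mat" where
  "unit_mat n i j = mat n n (\<lambda>(p, q). if p = i \<and> q = j then 1 else 0)"

lemma unit_mat_carrier [simp]: "unit_mat n i j \<in> carrier_mat n n"
  by (simp add: unit_mat_def)

lemma unit_mat_index [simp]:
  "p < n \<Longrightarrow> q < n \<Longrightarrow> unit_mat n i j $$ (p, q) = (if p = i \<and> q = j then 1 else 0)"
  by (simp add: unit_mat_def)

lemma unit_mat_dim [simp]: "dim_row (unit_mat n i j) = n" "dim_col (unit_mat n i j) = n"
  by (simp_all add: unit_mat_def)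

lemma upper_triangular_unit_mat [simp]: "i \<le> j \<Longrightarrow> upper_triangular (unit_mat n i j)"
  by (auto simp: upper_triangular_def)

lemma unit_mat_mult_index [simp]:
  fixes A :: "'a::semiring_1 mat"
  assumes "A \<in> carrier_mat n n" "i < n" "j < n" "p < n" "q < n"
  shows "(unit_mat n i j * A) $$ (p, q) = (if p = i then A $$ (j, q) else 0)"
using assms by (simp add: scalar_prod_def if_distrib[of "\<lambda>x. x * _"] if_distrib[of "\<lambda>x. _ * x"] if_distribR cong: if_cong)

lemma mult_unit_mat_index [simp]:
  fixes A :: "'a::semiring_1 mat"
  assumes "A \<in> carrier_mat n n" "i < n" "j < n" "p < n" "q < n"
  shows "(A * unit_mat n i j) $$ (p, q) = (if q = j then A $$ (p, i) else 0)"
using assms by (simp add: scalar_prod_def if_distrib[of "\<lambda>x. x * _"] if_distrib[of "\<lambda>x. _ * x"] if_distribR cong: if_cong)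

lemma unit_mat_mult_unit_mat:
  assumes "i < n" "j < n" "k < n" "l < n"
  shows "unit_mat n i j * unit_mat n k l = (if j = k then unit_mat n i l else 0\<^sub>m n n :: 'a::semiring_1 mat)"
  \<comment> \<open>Here and below, deleting \<open>index_mult_mat(1)\<close> keeps entries of
    products from unfolding into scalar products, so that the entry rules for products with a matrix
    unit apply.\<close>
  using assms by (intro eq_matI) (auto simp del: index_mult_mat(1))

text \<open>A nonzero entry can only be 1, so subtracting the matrix unit at its position clears
  that entry and changes no other. Induction on the number of nonzero entries then needs sums only,
  no scalar multiples.\<close>

lemma upper_triangular_unit_mat_induct [consumes 3, case_names zero unit add]:
  fixes A :: "'a::ring_1 mat"
  assumes "A \<in> carrier_mat n n" "upper_triangular A"
    and two: "\<And>x :: 'a. x = 0 \<or> x = 1"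
    and zero: "P (0\<^sub>m n n)"
    and unit: "\<And>i j. i \<le> j \<Longrightarrow> j < n \<Longrightarrow> P (unit_mat n i j)"
    and add: "\<And>A B. A \<in> carrier_mat n n \<Longrightarrow> upper_triangular A \<Longrightarrow> B \<in> carrier_mat n n \<Longrightarrow>
      upper_triangular B \<Longrightarrow> P A \<Longrightarrow> P B \<Longrightarrow> P (A + B)"
  shows "P A"
  using assms(1,2)
proof (induction "card {(i, j). i < n \<and> j < n \<and> A $$ (i, j) \<noteq> 0}" arbitrary: A rule: less_induct)
  case less
  let ?S = "\<lambda>A :: 'a mat. {(i, j). i < n \<and> j < n \<and> A $$ (i, j) \<noteq> 0}"
  show ?case
  proof (cases "?S A = {}")
    case True
    then have "A = 0\<^sub>m n n"
      using less.prems by (intro eq_matI) auto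
    then show ?thesis using zero by simp
  next
    case False
    then obtain i j where ij: "i < n" "j < n" "A $$ (i, j) \<noteq> 0" by auto
    then have le: "i \<le> j" and one: "A $$ (i, j) = 1"
      using less.prems two by (force simp: upper_triangular_def not_le[symmetric])+
    define B where "B = A - unit_mat n i j"
    have B: "B \<in> carrier_mat n n" "upper_triangular B"
      using less.prems le ij by (auto simp: B_def upper_triangular_def)
    have fin: "finite (?S A)"
      by (rule finite_subset[of _ "{..<n} \<times> {..<n}"]) auto
    have "?S B \<subseteq> ?S A - {(i, j)}"
      using less.prems one by (auto simp: B_def split: if_splits)
    then have "?S B \<subset> ?S A"
      using ij by auto
    then have "card (?S B) < card (?S A)"
      using fin by (rule psubset_card_mono[rotated])
    then have "P B"
      using less.hyps B by simp
    then have "P (B + unit_mat n i j)"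
      using B ij le by (intro add unit) auto
    moreover have "B + unit_mat n i j = A"
      using less.prems by (intro eq_matI) (auto simp: B_def)
    ultimately show ?thesis by simp
  qed
qed

subsection \<open>Jordan derivations of upper triangular matrices\<close>

locale upper_triangular_jordan_derivation =
  fixes n :: nat and D :: "'f::field mat \<Rightarrow> 'f mat"
  assumes jordan: "jordan_derivation (upper_triangular_ring TYPE('f) n) D"
begin

sublocale T: ring "upper_triangular_ring TYPE('f) n"
  by (rule ring_upper_triangular_ring)

lemma D_carrier [simp]: "A \<in> carrier_mat n n \<Longrightarrow> upper_triangular A \<Longrightarrow> D A \<in> carrier_mat n n"
  and D_upper [simp]: "A \<in> carrier_mat n n \<Longrightarrow> upper_triangular A \<Longrightarrow> upper_triangular (D A)"
  using T.jordan_derivation_closed[OF jordan, of A] by auto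

lemma D_dim [simp]:
  assumes "A \<in> carrier_mat n n" "upper_triangular A"
  shows "dim_row (D A) = n" "dim_col (D A) = n"
  using D_carrier[OF assms] by auto

lemma D_add:
  assumes "A \<in> carrier_mat n n" "upper_triangular A" "B \<in> carrier_mat n n" "upper_triangular B"
  shows "D (A + B) = D A + D B"
  using T.jordan_derivation_add[OF jordan, of A B] assms by simp

lemma D_zero: "D (0\<^sub>m n n) = 0\<^sub>m n n"
proof -
  have "D (0\<^sub>m n n) = D (0\<^sub>m n n * 0\<^sub>m n n)" by simp
  also have "\<dots> = 0\<^sub>m n n"
    using T.jordan_derivation_square[OF jordan, of "0\<^sub>m n n"] D_carrier[of "0\<^sub>m n n"]
    by (simp add: upper_triangular_def)
  finally show ?thesis .
qed

lemma D_lower: "A \<in> carrier_mat n n \<Longrightarrow> upper_triangular A \<Longrightarrow> q < p \<Longrightarrow> p < n \<Longrightarrow> D A $$ (p, q) = 0"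
  using D_carrier[of A] D_upper[of A] by (auto simp: upper_triangular_def)

lemma D_polarised:
  assumes "A \<in> carrier_mat n n" "upper_triangular A" "B \<in> carrier_mat n n" "upper_triangular B"
  shows "D (A * B + B * A) = D A * B + A * D B + D B * A + B * D A"
  using T.jordan_derivation_polarised[OF jordan, of A B] assms by simp

lemma D_polarised_index:
  assumes "A \<in> carrier_mat n n" "upper_triangular A" "B \<in> carrier_mat n n" "upper_triangular B"
    and "p < n" "q < n"
  shows "D (A * B + B * A) $$ (p, q) = (D A * B) $$ (p, q) + (A * D B) $$ (p, q)
    + (D B * A) $$ (p, q) + (B * D A) $$ (p, q)"
  unfolding D_polarised[OF assms(1-4)] using assms
  by (simp del: index_mult_mat(1))

text \<open>Compare entries in the square rule for the idempotent e_ii: off row i and column i both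
  summands vanish, and at (i, i) the rule reads x = x + x.\<close>

lemma D_diagonal_unit_index:
  assumes "i < n" "p < n" "q < n" and "(p = i) = (q = i)"
  shows "D (unit_mat n i i) $$ (p, q) = 0"
proof -
  let ?E = "unit_mat n i i"
  have "D (?E * ?E) = D ?E * ?E + ?E * D ?E"
    using T.jordan_derivation_square[OF jordan, of ?E] by simp
  then have "D ?E $$ (p, q) = (D ?E * ?E + ?E * D ?E) $$ (p, q)"
    using assms by (simp add: unit_mat_mult_unit_mat)
  also have "\<dots> = (if q = i then D ?E $$ (p, i) else 0) + (if p = i then D ?E $$ (i, q) else 0)"
    using assms by (simp del: index_mult_mat(1))
  finally show ?thesis
    using assms(4) by (cases "p = i") (metis add_cancel_right_right, simp)
qed

text \<open>The idempotents e_ii and e_jj are orthogonal, so their Jordan product is 0; this is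
  entry (i, j) of its polarised identity. It lets a single entry of \<open>Y\<close> correct both
  e_ii and e_jj.\<close>

lemma D_diagonal_unit_skew:
  assumes "i < n" "j < n" "i \<noteq> j"
  shows "D (unit_mat n j j) $$ (i, j) = - D (unit_mat n i i) $$ (i, j)"
proof -
  let ?E = "\<lambda>i. unit_mat n i i"
  have "D (?E i * ?E j + ?E j * ?E i) $$ (i, j) = 0"
    using assms by (simp add: unit_mat_mult_unit_mat D_zero)
  then show ?thesis
    using assms
    by (simp add: D_polarised_index eq_neg_iff_add_eq_0 add.commute del: index_mult_mat(1))
qed

text \<open>Since \<open>D\<close> kills e_ii and e_jj, polarisation confines nonzero entries to row
  or column i and also to row or column j. The corners (i, i) and (j, j) fail one of the two
  equations, and (j, i) lies below the diagonal.\<close>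

lemma D_unit_index:
  assumes kills: "\<And>i. i < n \<Longrightarrow> D (unit_mat n i i) = 0\<^sub>m n n"
    and "i < j" "j < n" "p < n" "q < n" and off: "(p, q) \<noteq> (i, j)"
  shows "D (unit_mat n i j) $$ (p, q) = 0"
proof -
  let ?E = "unit_mat n i j :: 'f mat"
  have "i < n" using assms by simp
  with assms have "?E = unit_mat n i i * ?E + ?E * unit_mat n i i"
    "?E = unit_mat n j j * ?E + ?E * unit_mat n j j"
    by (simp_all add: unit_mat_mult_unit_mat)
  then have "D ?E $$ (p, q) = D (unit_mat n i i * ?E + ?E * unit_mat n i i) $$ (p, q)"
    "D ?E $$ (p, q) = D (unit_mat n j j * ?E + ?E * unit_mat n j j) $$ (p, q)"
    by simp_all
  then have "D ?E $$ (p, q) = (if p = i then D ?E $$ (i, q) else 0) + (if q = i then D ?E $$ (p, i) else 0)"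
    "D ?E $$ (p, q) = (if p = j then D ?E $$ (j, q) else 0) + (if q = j then D ?E $$ (p, j) else 0)"
    using assms \<open>i < n\<close> by (simp_all add: D_polarised_index del: index_mult_mat(1))
  moreover have "D ?E $$ (j, i) = 0"
    using assms by (simp add: D_lower)
  ultimately show ?thesis
    using off \<open>i < j\<close> by (auto split: if_splits)
qed

lemma D_eq_zero:
  assumes two: "\<And>x :: 'f. x = 0 \<or> x = 1"
    and diag: "\<And>i. i < n \<Longrightarrow> D (unit_mat n i i) = 0\<^sub>m n n"
    and row: "\<And>j. 0 < j \<Longrightarrow> j < n \<Longrightarrow> D (unit_mat n 0 j) $$ (0, j) = 0"
    and A: "A \<in> carrier_mat n n" "upper_triangular A"
  shows "D A = 0\<^sub>m n n"
  using A two
proof (induction rule: upper_triangular_unit_mat_induct)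
  case (unit i j)
  show ?case
  proof (cases "i = j")
    case True
    then show ?thesis using diag unit by simp
  next
    case False
    with unit have ij: "i < j" by simp
    have "D (unit_mat n i j) $$ (i, j) = 0"
    proof (cases "i = 0")
      case True
      then show ?thesis using row ij unit by simp
    next
      case False
      \<comment> \<open>As 0 < i < j, \<open>?B * ?A\<close> is zero and the Jordan product is e_0j.
        In entry (0, j) the contribution of \<open>D ?A\<close> is its (0, i) entry, zero by
        \<open>row\<close>, which leaves exactly \<open>D ?B $$ (i, j)\<close>.\<close>
      let ?A = "unit_mat n 0 i" and ?B = "unit_mat n i j"
      have "D (?A * ?B + ?B * ?A) $$ (0, j) = 0"
        using row[of j] ij unit False by (simp add: unit_mat_mult_unit_mat)
      then show ?thesis
        using row[of i] ij unit False diag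
        by (simp add: D_polarised_index D_unit_index del: index_mult_mat(1))
    qed
    then show ?thesis
      using ij unit diag by (intro eq_matI) (auto, metis D_unit_index prod.inject)
  qed
qed (simp_all add: D_zero D_add)

end

section \<open>Normalisation by an inner derivation\<close>

lemma jordan_derivation_upper_triangular_inner:
  fixes D :: "'f::field mat \<Rightarrow> 'f mat"
  assumes two: "\<And>x :: 'f. x = 0 \<or> x = 1"
    and D: "jordan_derivation (upper_triangular_ring TYPE('f) n) D"
  shows "\<exists>Y. Y \<in> carrier_mat n n \<and> upper_triangular Y \<and>
    (\<forall>A. A \<in> carrier_mat n n \<longrightarrow> upper_triangular A \<longrightarrow> D A = A * Y - Y * A)"
proof -
  interpret D: upper_triangular_jordan_derivation n D
    by unfold_locales (rule D)
  \<comment> \<open>The commutator of e_ii with \<open>Y\<close> has entry (i, j) equal to Y_ij for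
    i < j, and that of e_0j has entry (0, j) equal to Y_jj - Y_00. Here Y_00 = 0, being a diagonal
    entry of D(e_00), so these values of \<open>Y\<close> are forced.\<close>
  define Y where "Y = mat n n (\<lambda>(i, j). if i < j then D (unit_mat n i i) $$ (i, j)
    else if i = j then D (unit_mat n 0 j) $$ (0, j) else 0)"
  have Y: "Y \<in> carrier_mat n n" "upper_triangular Y"
    by (auto simp: Y_def upper_triangular_def)
  \<comment> \<open>The case i < j need not be separated: below the diagonal \<open>D\<close> of a
    diagonal unit is 0 as well.\<close>
  have Y_index: "Y $$ (i, j) = (if i = j then D (unit_mat n 0 j) $$ (0, j) else D (unit_mat n i i) $$ (i, j))"
    if "i < n" "j < n" for i j
    using that by (auto simp: Y_def D.D_lower)
  define D' where "D' = (\<lambda>A. D A - (A * Y - Y * A))"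
  let ?R = "upper_triangular_ring TYPE('f) n"
  have inner: "derivation ?R (\<lambda>A. A \<otimes>\<^bsub>?R\<^esub> Y \<ominus>\<^bsub>?R\<^esub> Y \<otimes>\<^bsub>?R\<^esub> A)"
    using Y by (intro D.T.derivation_inner) simp
  have D'_eq: "D' A = D A \<ominus>\<^bsub>?R\<^esub> (A \<otimes>\<^bsub>?R\<^esub> Y \<ominus>\<^bsub>?R\<^esub> Y \<otimes>\<^bsub>?R\<^esub> A)" if "A \<in> carrier ?R" for A
    using that Y by (auto simp: D'_def upper_triangular_ring_minus upper_triangular_commutator)
  have "jordan_derivation ?R D'"
    using D.T.jordan_derivation_diff_derivation[OF D inner]
    by (auto simp: jordan_derivation_def hom_def D'_eq D.T.nat_pow_closed simp del: upper_triangular_ring_simps)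
  then interpret D': upper_triangular_jordan_derivation n D'
    by unfold_locales
  have D'_index: "D' A $$ (p, q) = D A $$ (p, q) - ((A * Y) $$ (p, q) - (Y * A) $$ (p, q))"
    if "A \<in> carrier_mat n n" "p < n" "q < n" for A p q
    using that Y by (simp add: D'_def del: index_mult_mat(1))
  have "D' A = 0\<^sub>m n n" if A: "A \<in> carrier_mat n n" "upper_triangular A" for A
  proof (rule D'.D_eq_zero[OF two _ _ A])
    show "D' (unit_mat n i i) = 0\<^sub>m n n" if "i < n" for i
    proof (rule eq_matI)
      fix p q assume "p < dim_row (0\<^sub>m n n :: 'f mat)" "q < dim_col (0\<^sub>m n n :: 'f mat)"
      \<comment> \<open>In row i off the diagonal, \<open>Y\<close> cancels \<open>D\<close> by
        definition; in column i, D(e_ii)_pi = - D(e_pp)_pi = - Y_pi by skewness. All remaining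
        entries vanish.\<close>
      then show "D' (unit_mat n i i) $$ (p, q) = 0\<^sub>m n n $$ (p, q)"
        using that Y
        by (auto simp: D'_index Y_index D.D_diagonal_unit_index D.D_diagonal_unit_skew simp del: index_mult_mat(1))
    qed (use that in auto)
    show "D' (unit_mat n 0 j) $$ (0, j) = 0" if "0 < j" "j < n" for j
      using that Y by (simp add: D'_index Y_index D.D_diagonal_unit_index del: index_mult_mat(1))
  qed
  then have eq: "D A = A * Y - Y * A" if "A \<in> carrier_mat n n" "upper_triangular A" for A
    using that Y D.T.r_right_minus_eq[of "D A" "A * Y - Y * A"]
    by (simp add: D'_def upper_triangular_ring_minus upper_triangular_commutator)
  with Y show ?thesis by blast
qed

theorem corollary2p1:
  fixes n :: nat and D :: "'f::field mat \<Rightarrow> 'f mat"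
  assumes "card (UNIV :: 'f set) = 2"
    and "n \<ge> 2"
    and "jordan_derivation (upper_triangular_ring TYPE('f) n) D"
  shows "derivation (upper_triangular_ring TYPE('f) n) D"
proof -
  let ?R = "upper_triangular_ring TYPE('f) n"
  interpret ring ?R by (rule ring_upper_triangular_ring)
  have "finite (UNIV :: 'f set)"
    using assms(1) by (intro card_ge_0_finite) simp
  then have "{0, 1} = (UNIV :: 'f set)"
    using assms(1) by (intro card_subset_eq) auto
  then have "x = 0 \<or> x = 1" for x :: 'f
    by blast
  from jordan_derivation_upper_triangular_inner[OF this assms(3)] obtain Y where Y: "Y \<in> carrier_mat n n" "upper_triangular Y"
    and eq: "\<And>A. A \<in> carrier_mat n n \<Longrightarrow> upper_triangular A \<Longrightarrow> D A = A * Y - Y * A"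
    by blast
  have "derivation ?R (\<lambda>A. A \<otimes>\<^bsub>?R\<^esub> Y \<ominus>\<^bsub>?R\<^esub> Y \<otimes>\<^bsub>?R\<^esub> A)"
    using Y by (intro derivation_inner) simp
  \<comment> \<open>\<open>D\<close> is known to equal the commutator only on the carrier, hence a
    transfer by congruence instead of equality of functions.\<close>
  then show ?thesis
    by (rule derivation_cong) (use Y in \<open>simp add: eq upper_triangular_commutator\<close>)
qed

end
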